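(* Let $\Phi$ be a (non-empty) set of target functions, and assume that $0\le\alpha(\Phi)<1$. Then $\Phi$ is compatible with respect to the fault-tolerant $(n,1)$-convergence problem (FC(1)).
   Context: Robot model. Robots $r_1,\dots,r_n$ are points in the plane $\mathbb{R}^2$, which carries a fixed right-handed global coordinate system $Z_0$. Time is discrete, $t=0,1,2,\dots$; $\mathbf{x}_t(r_i)$ is the position of $r_i$ at time $t$ in $Z_0$, and the configuration at $t$ is the multiset $P_t=\{\mathbf{x}_t(r_i):1\le i\le n\}$. Robot $r_i$ has a local coordinate system $Z_i$, right-handed, with its own unit length and axis directions (arbitrary, fixed over time), whose origin is always the current position of $r_i$; $\gamma_i$ denotes the coordinate transformation from $Z_i$ to $Z_0$ (an orientation-preserving similarity with $\gamma_i((0,0))=\mathbf{x}_t(r_i)$ at time $t$). A target function $\phi$ assigns to every multiset $P$ of $n$ points of $\mathbb{R}^2$ (for every $n\ge1$) an element of $\mathbb{R}^2\cup\{\bot\}$, with $\phi(P)=\bot$ if and only if $(0,0)\notin P$. Each robot $r_i$ is assigned a target function $\phi_i$. The scheduler is semi-synchronous: at each time $t$ an arbitrary subset of robots is activated; if a non-crashed $r_i$ is activated at $t$ then $\mathbf{x}_{t+1}(r_i)=\gamma_i(\phi_i(\gamma_i^{-1}(P_t)))$, otherwise $\mathbf{x}_{t+1}(r_i)=\mathbf{x}_t(r_i)$. The schedule is fair: every robot is activated infinitely often. A faulty robot may crash at an arbitrary time, after which it never moves again; crashed robots cannot be distinguished from other robots. The sequence $P_0,P_1,\dots$ is an execution.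 Scale. $CH(P)$ is the convex hull of $P$, $g(P)=\frac1n\sum_{\mathbf{x}\in P}\mathbf{x}$ (with multiplicity), and $d*CH(P)=\{d\mathbf{x}+(1-d)g(P):\mathbf{x}\in CH(P)\}$ for $d\ge0$. $\alpha(\phi,P)$ is the smallest $d\ge 0$ with $\phi(P)\in d*CH(P)$ (and $0$ if $\phi(P)=\bot$; $\infty$ if there is no such $d$). $\alpha(\phi)=\sup_P\alpha(\phi,P)$ and $\alpha(\Phi)=\sup_{\phi\in\Phi}\alpha(\phi)$. Compatibility. $\Phi$ is compatible with respect to FC(1) if, for every number $n\ge2$ of robots, every assignment of target functions from $\Phi$ to the robots (different robots may get different ones), every choice of local coordinate systems, every initial configuration, every fair schedule and every pattern of crashes in which at most one robot is faulty, all non-faulty robots converge to one common point as $t\to\infty$. *)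

theory Defs
  imports "HOL-Analysis.Analysis" "HOL-Library.Multiset"
begin

type_synonym target = "(real^2) multiset \<Rightarrow> (real^2) option"

text \<open>The result \<open>None\<close> stands for the undefined value. Configurations have at least one robot,
  so the value at the empty multiset is irrelevant and left unconstrained.\<close>

definition target_function :: "target \<Rightarrow> bool" where
  "target_function \<phi> \<longleftrightarrow> (\<forall>P. P \<noteq> {#} \<longrightarrow> (\<phi> P = None \<longleftrightarrow> 0 \<notin># P))"

definition centroid :: "(real^2) multiset \<Rightarrow> real^2" where
  "centroid P = (1 / real (size P)) *\<^sub>R (\<Sum>\<^sub># P)"

definition scaled_hull :: "real \<Rightarrow> (real^2) multiset \<Rightarrow> (real^2) set" where
  "scaled_hull d P = {d *\<^sub>R x + (1 - d) *\<^sub>R centroid P | x. x \<in> convex hull (set_mset P)}"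

text \<open>The infimum of the empty set is \<open>\<infinity>\<close> in \<^typ>\<open>ereal\<close>; a nonempty infimum
  is a minimum, see \<open>scale_at_attained\<close> below.\<close>

definition scale_at :: "target \<Rightarrow> (real^2) multiset \<Rightarrow> ereal" where
  "scale_at \<phi> P = (case \<phi> P of None \<Rightarrow> 0
     | Some y \<Rightarrow> Inf {ereal d | d. 0 \<le> d \<and> y \<in> scaled_hull d P})"

definition scale :: "target \<Rightarrow> ereal" where
  "scale \<phi> = (SUP P\<in>{P. P \<noteq> {#}}. scale_at \<phi> P)"

definition scale_set :: "target set \<Rightarrow> ereal" where
  "scale_set \<Phi> = (SUP \<phi>\<in>\<Phi>. scale \<phi>)"

lemma scale_at_attained:
  assumes "\<phi> P = Some y" "0 \<le> d" "y \<in> scaled_hull d P"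
  shows "\<exists>d0\<ge>0. y \<in> scaled_hull d0 P \<and> scale_at \<phi> P = ereal d0
           \<and> (\<forall>e\<ge>0. y \<in> scaled_hull e P \<longrightarrow> d0 \<le> e)"
proof -
  define K where "K = ({0..d} \<times> (convex hull (set_mset P))) \<inter>
    {z. fst z *\<^sub>R snd z + (1 - fst z) *\<^sub>R centroid P = y}"
  have "closed {z::real \<times> (real^2). fst z *\<^sub>R snd z + (1 - fst z) *\<^sub>R centroid P = y}"
    by (intro closed_Collect_eq continuous_intros)
  then have "compact K"
    unfolding K_def
    by (intro compact_Int_closed compact_Times compact_Icc compact_convex_hull
        finite_imp_compact finite_set_mset)
  then have "compact (fst ` K)"
    by (intro compact_continuous_image continuous_intros)
  moreover have mem: "e \<in> fst ` K \<longleftrightarrow> 0 \<le> e \<and> e \<le> d \<and> y \<in> scaled_hull e P" for e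
    by (force simp: K_def scaled_hull_def image_iff)
  moreover have "fst ` K \<noteq> {}" using mem[of d] assms by auto
  ultimately obtain d0 where d0: "d0 \<in> fst ` K" "\<forall>e\<in>fst ` K. d0 \<le> e"
    using compact_attains_inf by blast
  have min: "d0 \<le> e" if "0 \<le> e" "y \<in> scaled_hull e P" for e
    using d0 that mem[of e] mem[of d0] by (cases "e \<le> d") auto
  have "Inf {ereal e | e. 0 \<le> e \<and> y \<in> scaled_hull e P} = ereal d0"
    using d0(1) min mem by (intro antisym Inf_lower Inf_greatest) auto
  then show ?thesis
    using assms(1) d0(1) min mem by (auto simp: scale_at_def)
qed

text \<open>\<open>frame s R c\<close> maps local to global coordinates, for a right-handed local system with
  unit length \<open>s\<close>, axes given by the columns of \<open>R\<close>, and origin \<open>c\<close>. With \<open>s > 0\<close> and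
  \<open>R\<close> a rotation matrix these are exactly the orientation-preserving similarities of the plane
  sending the origin to \<open>c\<close>.\<close>

definition frame :: "real \<Rightarrow> real^2^2 \<Rightarrow> real^2 \<Rightarrow> real^2 \<Rightarrow> real^2" where
  "frame s R c v = c + s *\<^sub>R (R *v v)"

definition configuration :: "nat \<Rightarrow> (nat \<Rightarrow> real^2) \<Rightarrow> (real^2) multiset" where
  "configuration n p = image_mset p (mset_set {..<n})"

definition fair_schedule :: "nat \<Rightarrow> (nat \<Rightarrow> nat set) \<Rightarrow> bool" where
  "fair_schedule n act \<longleftrightarrow> (\<forall>t. act t \<subseteq> {..<n}) \<and> (\<forall>i<n. infinite {t. i \<in> act t})"

text \<open>Robots are \<open>0, ..., n - 1\<close>, and \<open>x t i\<close> is the global position of robot \<open>i\<close> at time \<open>t\<close>.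
  Robot \<open>i\<close> is crashed from time \<open>crash i\<close> on and is non-faulty iff \<open>crash i = \<infinity>\<close>.
  The local view of a robot always contains the origin, so for target functions the
  argument of \<open>the\<close> is never \<open>None\<close>.\<close>

definition execution ::
  "nat \<Rightarrow> (nat \<Rightarrow> target) \<Rightarrow> (nat \<Rightarrow> real) \<Rightarrow> (nat \<Rightarrow> real^2^2) \<Rightarrow> (nat \<Rightarrow> nat set) \<Rightarrow>
   (nat \<Rightarrow> enat) \<Rightarrow> (nat \<Rightarrow> nat \<Rightarrow> real^2) \<Rightarrow> bool" where
  "execution n \<phi> s R act crash x \<longleftrightarrow>
     (\<forall>t. \<forall>i<n. x (Suc t) i =
        (if i \<in> act t \<and> enat t < crash i
         then (let \<gamma> = frame (s i) (R i) (x t i)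
               in \<gamma> (the (\<phi> i (image_mset (inv \<gamma>) (configuration n (x t))))))
         else x t i))"

definition compatible_FC1 :: "target set \<Rightarrow> bool" where
  "compatible_FC1 \<Phi> \<longleftrightarrow>
     (\<forall>n \<phi> s R act crash x.
        n \<ge> 2 \<and>
        (\<forall>i<n. \<phi> i \<in> \<Phi>) \<and>
        (\<forall>i<n. s i > 0 \<and> rotation_matrix (R i)) \<and>
        fair_schedule n act \<and>
        card {i. i < n \<and> crash i \<noteq> \<infinity>} \<le> 1 \<and>
        execution n \<phi> s R act crash x
        \<longrightarrow> (\<exists>p. \<forall>i<n. crash i = \<infinity> \<longrightarrow> (\<lambda>t. x t i) \<longlonglongrightarrow> p))"

end

theory Submission imports Defs begin

text \<open>Fix a linear functional on the plane, a bound \<open>a < 1\<close> on the scale, and let \<open>lo\<close> and \<open>hi\<close> be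
  the least and greatest value of the functional on the current configuration. A robot that moves
  lands in \<open>a*CH\<close>, hence its new value keeps a distance of at least
  \<open>\<delta> (hi - lo)\<close> with \<open>\<delta> = (1 - a) / n\<close> from both ends. Thus \<open>hi\<close> decreases to some
  \<open>M\<close> and \<open>lo\<close> increases to some \<open>m\<close>. If \<open>m < M\<close>, then every robot that moves late enough stays
  strictly between \<open>m\<close> and \<open>M\<close> from then on, so that in the end the single faulty robot
  has to be at both ends of the configuration. Hence \<open>m = M\<close> for every functional.\<close>

text \<open>The hull part of \<open>y\<close> never exceeds \<open>M\<close>, so the gain comes from
  the centroid. There \<open>w\<close> alone contributes a deficit of \<open>M - l w\<close>,
  divided by the number of points, and the weight \<open>1 - d\<close> carries it over to
  \<open>y\<close>. The bounds on \<open>d\<close> keep both weights nonnegative.\<close>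

lemma linear_le_scaled_hull:
  fixes l :: "real^2 \<Rightarrow> real"
  assumes l: "linear l" and y: "y \<in> scaled_hull d P" and d: "0 \<le> d" "d \<le> 1"
    and M: "\<And>v. v \<in># P \<Longrightarrow> l v \<le> M" and w: "w \<in># P"
  shows "l y \<le> M - (1 - d) * (M - l w) / real (size P)"
proof -
  interpret linear l by (fact l)
  obtain z where z: "z \<in> convex hull (set_mset P)"
    and yz: "y = d *\<^sub>R z + (1 - d) *\<^sub>R centroid P"
    using y by (auto simp: scaled_hull_def)
  have "convex {v. l v \<le> M}"
    using convex_linear_vimage[OF l, of "{..M}"] by (simp add: vimage_def)
  then have lz: "l z \<le> M"
    using hull_minimal[of "set_mset P" "{v. l v \<le> M}" convex] M z by auto
  have sum_l: "l (\<Sum>\<^sub># Q) = (\<Sum>v\<in>#Q. l v)" for Q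
    by (induction Q) (auto simp: add zero)
  obtain Q where Q: "P = add_mset w Q"
    using w by (metis insert_DiffM)
  have "(\<Sum>v\<in>#Q. l v) \<le> (\<Sum>v\<in>#Q. M)"
    using M Q by (intro sum_mset_mono) auto
  then have "l (\<Sum>\<^sub># P) \<le> real (size P) * M - (M - l w)"
    by (simp add: Q add sum_l algebra_simps)
  then have "l (\<Sum>\<^sub># P) / real (size P) \<le> (real (size P) * M - (M - l w)) / real (size P)"
    by (rule divide_right_mono) simp
  moreover define q where "q = (M - l w) / real (size P)"
  ultimately have "l (centroid P) \<le> M - q"
    using w by (simp add: centroid_def scale diff_divide_distrib Q)
  then have "(1 - d) * l (centroid P) \<le> (1 - d) * (M - q)"
    using d by (intro mult_left_mono) auto
  moreover have "d * l z \<le> d * M"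
    using d lz by (intro mult_left_mono) auto
  moreover have "l y = d * l z + (1 - d) * l (centroid P)"
    by (simp only: yz add scale real_scaleR_def)
  ultimately have "l y \<le> M - (1 - d) * q"
    by (simp add: algebra_simps)
  then show ?thesis
    by (simp add: q_def)
qed

text \<open>An infimum strictly below \<open>a\<close> has a witness below \<open>a\<close>, so
  working with a strict bound avoids any appeal to attained minima.\<close>

lemma scale_set_less_imp_scaled_hull:
  assumes "scale_set \<Phi> < ereal a" "\<phi> \<in> \<Phi>" "P \<noteq> {#}" "\<phi> P = Some y"
  shows "\<exists>d\<ge>0. d < a \<and> y \<in> scaled_hull d P"
proof -
  have "scale_at \<phi> P \<le> scale_set \<Phi>"
    unfolding scale_set_def scale_def using assms by (meson SUP_upper SUP_upper2 mem_Collect_eq)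
  then have "Inf {ereal d | d. 0 \<le> d \<and> y \<in> scaled_hull d P} < ereal a"
    using le_less_trans[OF _ assms(1)] assms(4) by (simp add: scale_at_def)
  then show ?thesis
    unfolding Inf_less_iff by auto
qed

lemma bij_frame:
  assumes "0 < s" "rotation_matrix R"
  shows "bij (frame s R c)"
proof -
  have "invertible R"
    using assms by (simp add: rotation_matrix_def invertible_det_nz)
  then have R: "bij ((*v) R)"
    by (simp add: invertible_eq_bij)
  have "bij (\<lambda>v. c + s *\<^sub>R v)"
    by (rule bij_betw_byWitness[where f' = "\<lambda>v. (1 / s) *\<^sub>R (v - c)"]) (use assms in auto)
  from bij_comp[OF R this] show ?thesis
    by (simp add: frame_def[abs_def] comp_def)
qed

text \<open>The scale is measured in local coordinates, the bound is wanted in global ones. A frame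
  is affine, so \<open>l\<close> can be pulled back to the local view, where
  \<open>linear_le_scaled_hull\<close> applies.\<close>

lemma linear_le_robot_move:
  fixes l :: "real^2 \<Rightarrow> real" and p :: "nat \<Rightarrow> real^2"
  defines "new \<equiv> \<lambda>\<phi> s R n p i. frame s R (p i)
    (the (\<phi> (image_mset (inv (frame s R (p i))) (configuration n p))))"
  assumes l: "linear l" and a: "scale_set \<Phi> < ereal a" "a < 1"
    and \<phi>: "\<phi> \<in> \<Phi>" "target_function \<phi>" and frame: "0 < s" "rotation_matrix R" and i: "i < n"
    and M: "\<And>j. j < n \<Longrightarrow> l (p j) \<le> M" and k: "k < n"
  shows "l (new \<phi> s R n p i) \<le> M - (1 - a) / real n * (M - l (p k))"
proof -
  define \<gamma> where "\<gamma> = frame s R (p i)"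
  define Q where "Q = image_mset (inv \<gamma>) (configuration n p)"
  \<comment> \<open>The linear part of \<open>l\<close> composed with \<open>\<gamma>\<close>; the
    constant left over is \<open>l (p i)\<close>.\<close>
  define l' where "l' v = s * l (R *v v)" for v
  interpret linear l by (fact l)
  have bij: "bij \<gamma>"
    unfolding \<gamma>_def using frame by (rule bij_frame)
  have \<gamma>_inv: "\<gamma> (inv \<gamma> v) = v" for v
    using bij by (simp add: bij_is_surj surj_f_inv_f)
  have Q: "v \<in># Q \<longleftrightarrow> (\<exists>j<n. v = inv \<gamma> (p j))" for v
    by (auto simp: Q_def configuration_def)
  have size: "size Q = n"
    by (simp add: Q_def configuration_def)
  have l'_\<gamma>: "l (\<gamma> v) = l (p i) + l' v" for v
    by (simp add: \<gamma>_def frame_def l'_def add scale)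
  have l'_inv: "l' (inv \<gamma> v) = l v - l (p i)" for v
    using l'_\<gamma>[of "inv \<gamma> v"] by (simp add: \<gamma>_inv)
  have l': "linear l'"
    by (rule linearI) (simp_all add: l'_def matrix_vector_right_distrib
        matrix_vector_mult_scaleR add scale algebra_simps)
  have "\<gamma> 0 = p i"
    by (simp add: \<gamma>_def frame_def)
  then have "inv \<gamma> (p i) = 0"
    using bij by (metis bij_is_inj inv_f_f)
  then have "0 \<in># Q"
    using i Q by metis
  then have ne: "Q \<noteq> {#}"
    by (metis empty_iff set_mset_empty)
  then have "\<phi> Q \<noteq> None"
    using \<phi>(2) \<open>0 \<in># Q\<close> by (simp add: target_function_def)
  then obtain y where y: "\<phi> Q = Some y"
    by blast
  obtain d where d: "0 \<le> d" "d < a" "y \<in> scaled_hull d Q"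
    using scale_set_less_imp_scaled_hull[OF a(1) \<phi>(1) ne y] by auto
  have "l' y \<le> (M - l (p i)) - (1 - d) * ((M - l (p i)) - l' (inv \<gamma> (p k))) / real (size Q)"
  proof (rule linear_le_scaled_hull[OF l' d(3)])
    show "l' v \<le> M - l (p i)" if "v \<in># Q" for v
      using that Q M by (auto simp: l'_inv)
    show "inv \<gamma> (p k) \<in># Q"
      using Q k by auto
  qed (use d a in auto)
  then have "l (\<gamma> y) \<le> M - (1 - d) / real n * (M - l (p k))"
    by (simp add: l'_\<gamma> l'_inv size)
  \<comment> \<open>The \<open>d\<close> found depends on the view; passing to \<open>a\<close>
    makes the factor uniform over time and robots. This uses
    \<open>M - l (p k) \<ge> 0\<close>.\<close>
  moreover have "(1 - a) / real n * (M - l (p k)) \<le> (1 - d) / real n * (M - l (p k))"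
    using d M[OF k] by (intro mult_right_mono divide_right_mono) auto
  ultimately show ?thesis
    using y unfolding new_def Q_def \<gamma>_def by simp
qed

text \<open>The one-dimensional core, free of geometry: \<open>u t i\<close> stands for a coordinate
  of robot \<open>i\<close>, and \<open>F\<close> for the faulty robots. Members of \<open>F\<close>
  converge as well, being squeezed between \<open>lo\<close> and \<open>hi\<close>.\<close>

lemma inward_moves_converge:
  fixes u :: "nat \<Rightarrow> nat \<Rightarrow> real" and n :: nat
  defines "hi \<equiv> \<lambda>t. Max (u t ` {..<n})" and "lo \<equiv> \<lambda>t. Min (u t ` {..<n})"
  defines "inward \<equiv> \<lambda>\<delta> t i. lo t + \<delta> * (hi t - lo t) \<le> u (Suc t) i \<and>
    u (Suc t) i \<le> hi t - \<delta> * (hi t - lo t)"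
  assumes n: "0 < n" and \<delta>: "0 < \<delta>"
    and stay_or_inward: "\<And>t i. i < n \<Longrightarrow> u (Suc t) i = u t i \<or> inward \<delta> t i"
    and F: "finite F" "card F \<le> 1"
    and move: "\<And>i. i < n \<Longrightarrow> i \<notin> F \<Longrightarrow> \<exists>\<^sub>\<infinity>t. inward \<delta> t i"
  shows "\<exists>p. \<forall>i<n. (\<lambda>t. u t i) \<longlonglongrightarrow> p"
proof -
  have le_hi: "u t i \<le> hi t" and lo_le: "lo t \<le> u t i" if "i < n" for t i
    using that by (auto simp: hi_def lo_def)
  have ne: "u t ` {..<n} \<noteq> {}" for t
    using n by (auto simp: lessThan_empty_iff)
  have "hi t \<in> u t ` {..<n}" for t
    unfolding hi_def using ne by (intro Max_in) auto
  then have hi_att: "\<exists>i<n. u t i = hi t" for t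
    by (metis imageE lessThan_iff)
  have "lo t \<in> u t ` {..<n}" for t
    unfolding lo_def using ne by (intro Min_in) auto
  then have lo_att: "\<exists>i<n. u t i = lo t" for t
    by (metis imageE lessThan_iff)
  have lo_hi: "lo t \<le> hi t" for t
    using le_hi[OF n] lo_le[OF n] by (rule order_trans[rotated])
  have bounds: "lo t \<le> u (Suc t) i \<and> u (Suc t) i \<le> hi t" if "i < n" for t i
  proof -
    have "0 \<le> \<delta> * (hi t - lo t)"
      using \<delta> lo_hi[of t] by simp
    then show ?thesis
      using stay_or_inward[OF that, of t] le_hi[OF that, of t] lo_le[OF that, of t]
      by (auto simp: inward_def)
  qed
  have dec: "decseq hi"
    using hi_att bounds by (metis decseq_SucI)
  have inc: "incseq lo"
    using lo_att bounds by (metis incseq_SucI)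
  have "lo 0 \<le> hi t" "lo t \<le> hi 0" for t
    using lo_hi[of t] incseqD[OF inc, of 0 t] decseqD[OF dec, of 0 t] by auto
  then obtain M m where hi: "hi \<longlonglongrightarrow> M" "\<And>t. M \<le> hi t" and lo: "lo \<longlonglongrightarrow> m" "\<And>t. lo t \<le> m"
    using decseq_convergent[OF dec, of "lo 0"] incseq_convergent[OF inc, of "hi 0"] by metis
  have "m \<le> M"
    using LIMSEQ_le[OF lo(1) hi(1)] lo_hi by blast
  have "m = M"
  proof (rule ccontr)
    assume "m \<noteq> M"
    \<comment> \<open>Since \<open>hi t - lo t \<ge> M - m\<close>, an inward move keeps a margin of
      at least \<open>e\<close>. Once \<open>hi\<close> and \<open>lo\<close> are within
      \<open>e\<close> of their limits, such a move lands strictly between \<open>m\<close> and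
      \<open>M\<close>.\<close>
    define e where "e = \<delta> * (M - m)"
    have "0 < e"
      using \<open>m \<le> M\<close> \<open>m \<noteq> M\<close> \<delta> by (simp add: e_def)
    then have "\<forall>\<^sub>F t in sequentially. hi t < M + e \<and> m - e < lo t"
      using order_tendstoD(2)[OF hi(1), of "M + e"] order_tendstoD(1)[OF lo(1), of "m - e"]
      by (simp add: eventually_conj)
    then obtain T where T: "\<And>t. T \<le> t \<Longrightarrow> hi t < M + e \<and> m - e < lo t"
      by (auto simp: eventually_sequentially)
    have inside: "m < u (Suc t) i \<and> u (Suc t) i < M" if "T \<le> t" "inward \<delta> t i" for t i
    proof -
      have "e \<le> \<delta> * (hi t - lo t)"
        unfolding e_def using hi(2)[of t] lo(2)[of t] \<delta> by (intro mult_left_mono) auto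
      then show ?thesis
        using that T[OF that(1)] by (auto simp: inward_def)
    qed
    have "\<forall>\<^sub>F t in sequentially. m < u t i \<and> u t i < M" if i: "i \<in> {..<n} - F" for i
    proof -
      obtain t0 where t0: "T \<le> t0" "inward \<delta> t0 i"
        using move[of i] i by (auto simp: INFM_nat_le)
      \<comment> \<open>The move made at \<open>t0\<close> shows at \<open>Suc t0\<close>.
        Afterwards a robot either keeps its interior value or moves inward again.\<close>
      have "m < u t i \<and> u t i < M" if "Suc t0 \<le> t" for t
        using that
      proof (induction t rule: dec_induct)
        case base
        show ?case using inside[OF t0] .
      next
        case (step t)
        then show ?case
          using stay_or_inward[of i t] i inside[of t i] t0(1) by auto
      qed
      then show ?thesis
        by (auto simp: eventually_sequentially)
    qed
    then have "\<forall>\<^sub>F t in sequentially. \<forall>i\<in>{..<n} - F. m < u t i \<and> u t i < M"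
      by (intro eventually_ball_finite) auto
    then obtain t where t: "\<And>i. i \<in> {..<n} - F \<Longrightarrow> m < u t i \<and> u t i < M"
      by (auto simp: eventually_sequentially)
    \<comment> \<open>The extremes lie outside the open interval from \<open>m\<close> to
      \<open>M\<close>, so only robots in \<open>F\<close> can attain them; with a single such
      robot, \<open>hi t = lo t\<close>.\<close>
    obtain i j where ij: "i < n" "u t i = hi t" "j < n" "u t j = lo t"
      using hi_att lo_att by metis
    have "i \<in> F" "j \<in> F"
      using t[of i] t[of j] ij hi(2)[of t] lo(2)[of t] by fastforce+
    then have "i = j"
      using F card_le_Suc0_iff_eq[of F] by auto
    then show False
      using ij hi(2)[of t] lo(2)[of t] \<open>m \<le> M\<close> \<open>m \<noteq> M\<close> by auto
  qed
  have "(\<lambda>t. u t i) \<longlonglongrightarrow> M" if "i < n" for i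
  proof (rule tendsto_sandwich)
    show "lo \<longlonglongrightarrow> M" "hi \<longlonglongrightarrow> M"
      using lo(1) hi(1) \<open>m = M\<close> by simp_all
  qed (use lo_le le_hi that in auto)
  then show ?thesis
    by blast
qed

theorem corollary2:
  fixes \<Phi> :: "target set"
  assumes "\<Phi> \<noteq> {}"
    and "\<forall>\<phi>\<in>\<Phi>. target_function \<phi>"
    and "0 \<le> scale_set \<Phi>" and "scale_set \<Phi> < 1"
  shows "compatible_FC1 \<Phi>"
  unfolding compatible_FC1_def
proof (intro allI impI, elim conjE)
  fix n \<phi> s R act crash and x :: "nat \<Rightarrow> nat \<Rightarrow> real^2"
  assume n: "2 \<le> n" and \<phi>: "\<forall>i<n. \<phi> i \<in> \<Phi>" and sR: "\<forall>i<n. 0 < s i \<and> rotation_matrix (R i)"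
    and fair: "fair_schedule n act" and faulty: "card {i. i < n \<and> crash i \<noteq> \<infinity>} \<le> 1"
    and ex: "execution n \<phi> s R act crash x"
  obtain a where a: "scale_set \<Phi> < ereal a" "a < 1"
    using assms(4) ereal_dense2[of "scale_set \<Phi>" 1] by auto
  \<comment> \<open>Convergence in the plane is checked one coordinate at a time.\<close>
  have "\<exists>p. \<forall>i<n. (\<lambda>t. x t i $ k) \<longlonglongrightarrow> p" for k
  proof -
    define u where "u t i = x t i $ k" for t i
    define hi where "hi t = Max (u t ` {..<n})" for t
    define lo where "lo t = Min (u t ` {..<n})" for t
    define \<delta> where "\<delta> = (1 - a) / real n"
    define moves where "moves t i \<longleftrightarrow> i \<in> act t \<and> enat t < crash i" for t i
    have inward: "lo t + \<delta> * (hi t - lo t) \<le> u (Suc t) i \<and>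
        u (Suc t) i \<le> hi t - \<delta> * (hi t - lo t)"
      if i: "i < n" and "moves t i" for t i
    proof -
      have x: "x (Suc t) i = frame (s i) (R i) (x t i)
          (the (\<phi> i (image_mset (inv (frame (s i) (R i) (x t i))) (configuration n (x t)))))"
        using ex that by (simp add: execution_def Let_def moves_def)
      have ne: "u t ` {..<n} \<noteq> {}"
        using n by (auto simp: lessThan_empty_iff)
      have "lo t \<in> u t ` {..<n}" "hi t \<in> u t ` {..<n}"
        unfolding hi_def lo_def using ne by (simp_all only: Max_in Min_in finite_imageI finite_lessThan not_False_eq_True)
      then obtain j k' where j: "j < n" "u t j = lo t" and k': "k' < n" "u t k' = hi t"
        by (metis imageE lessThan_iff)
      have bounds: "u t i \<le> hi t" "lo t \<le> u t i" if "i < n" for i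
        using that by (auto simp: hi_def lo_def)
      have \<phi>i: "\<phi> i \<in> \<Phi>" "target_function (\<phi> i)" and sRi: "0 < s i" "rotation_matrix (R i)"
        using \<phi> sR assms(2) i by auto
      \<comment> \<open>The negated coordinate turns the upper bound of
        \<open>linear_le_robot_move\<close> into the lower one. Each time the reference robot sits
        at the opposite end, \<open>j\<close> at \<open>lo t\<close> and \<open>k'\<close> at
        \<open>hi t\<close>, so the margin is the full
        \<open>\<delta> * (hi t - lo t)\<close>.\<close>
      have "linear (\<lambda>v::real^2. v $ k)" "linear (\<lambda>v::real^2. - v $ k)"
        by (auto intro: linearI)
      note move = this[THEN linear_le_robot_move[OF _ a \<phi>i sRi i], of "x t"]
      have "u (Suc t) i \<le> hi t - \<delta> * (hi t - lo t)"
        using move(1)[OF _ j(1), of "hi t"] bounds j(2) by (simp add: u_def x \<delta>_def)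
      moreover have "- u (Suc t) i \<le> - lo t - \<delta> * (- lo t - - hi t)"
        using move(2)[OF _ k'(1), of "- lo t"] bounds k'(2) by (simp add: u_def x \<delta>_def)
      ultimately show ?thesis
        by (simp add: algebra_simps)
    qed
    have stay: "u (Suc t) i = u t i" if "i < n" "\<not> moves t i" for t i
      using ex that by (auto simp: execution_def u_def moves_def)
    have "\<exists>p. \<forall>i<n. (\<lambda>t. u t i) \<longlonglongrightarrow> p"
    proof (rule inward_moves_converge[of n \<delta> u "{i. i < n \<and> crash i \<noteq> \<infinity>}"];
        (fold hi_def lo_def)?)
      show "0 < n" "0 < \<delta>"
        using n a by (auto simp: \<delta>_def)
      show "u (Suc t) i = u t i \<or> lo t + \<delta> * (hi t - lo t) \<le> u (Suc t) i \<and>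
        u (Suc t) i \<le> hi t - \<delta> * (hi t - lo t)" if "i < n" for t i
        using inward stay that by blast
      show "\<exists>\<^sub>\<infinity>t. lo t + \<delta> * (hi t - lo t) \<le> u (Suc t) i \<and>
        u (Suc t) i \<le> hi t - \<delta> * (hi t - lo t)"
        if i: "i < n" "i \<notin> {i. i < n \<and> crash i \<noteq> \<infinity>}" for i
      proof -
        \<comment> \<open>Here \<open>crash i = \<infinity>\<close>, so every activation of
          \<open>i\<close> is an actual move.\<close>
        have "\<exists>\<^sub>\<infinity>t. i \<in> act t"
          using fair i by (simp add: fair_schedule_def frequently_cofinite)
        then show ?thesis
          by (rule frequently_elim1) (use inward i in \<open>auto simp: moves_def\<close>)
      qed
    qed (use faulty in auto)
    then show ?thesis
      by (simp add: u_def)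
  qed
  then obtain p where "\<And>k i. i < n \<Longrightarrow> (\<lambda>t. x t i $ k) \<longlonglongrightarrow> p k"
    by metis
  then have "(\<lambda>t. x t i) \<longlonglongrightarrow> (\<chi> k. p k)" if "i < n" for i
    using that by (intro vec_tendstoI) simp
  then show "\<exists>p. \<forall>i<n. crash i = \<infinity> \<longrightarrow> (\<lambda>t. x t i) \<longlonglongrightarrow> p"
    by blast
qed

end
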